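(* Let $A\in\mathbb{R}^{m\times n}$ with $m\le n$, and let $p>n$. Then $A$ has the strong inner product property if and only if the $m\times p$ matrix $B=\left[\begin{array}{c|c}A & O\end{array}\right]$ (where $O$ is the $m\times(p-n)$ zero matrix) has the strong inner product property.
   Context: All matrices are real; $\circ$ denotes the Hadamard product. A matrix $M\in\mathbb{R}^{m\times n}$ with $m\le n$ has the strong inner product property (SIPP) if $M$ has rank $m$ and $X=O$ is the only symmetric $m\times m$ matrix $X$ with $(XM)\circ M=O$. *)

theory Defs
  imports "Jordan_Normal_Form.DL_Rank"
begin

(* Only used for matrices of equal dimensions. *)
definition hadamard :: "'a :: times mat \<Rightarrow> 'a mat \<Rightarrow> 'a mat" (infixl "\<circ>\<^sub>H" 70) where
  "M \<circ>\<^sub>H N = mat (dim_row M) (dim_col M) (\<lambda>(i, j). M $$ (i, j) * N $$ (i, j))"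

(* Column analogue of append_rows: the block matrix [A | B]. *)
definition append_cols :: "'a :: zero mat \<Rightarrow> 'a mat \<Rightarrow> 'a mat" (infixr "@\<^sub>c" 65) where
  "A @\<^sub>c B = four_block_mat A B (0\<^sub>m 0 (dim_col A)) (0\<^sub>m 0 (dim_col B))"

(* The first value argument of vec_space.rank is the dimension of the space containing
   the columns, i.e. the number of rows. *)
definition has_SIPP :: "real mat \<Rightarrow> bool" where
  "has_SIPP M \<longleftrightarrow>
     dim_row M \<le> dim_col M \<and>
     vec_space.rank (dim_row M) M = dim_row M \<and>
     (\<forall>X \<in> carrier_mat (dim_row M) (dim_row M).
        X\<^sup>T = X \<longrightarrow> (X * M) \<circ>\<^sub>H M = 0\<^sub>m (dim_row M) (dim_col M) \<longrightarrow>
        X = 0\<^sub>m (dim_row M) (dim_row M))"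

end

theory Submission
  imports Defs
begin

(* Zero columns add nothing to the span of the columns. Left multiplication and the Hadamard
   product both act blockwise on [A | B], so (X [A | B]) o [A | B] = O splits into one equation
   for A and one for B, and the latter is vacuous for B = O. *)

lemma dim_append_cols [simp]:
  "dim_row (A @\<^sub>c B) = dim_row A"
  "dim_col (A @\<^sub>c B) = dim_col A + dim_col B"
  by (simp_all add: append_cols_def)

lemma carrier_append_cols [simp, intro]:
  assumes "A \<in> carrier_mat m n" and "B \<in> carrier_mat m k"
  shows "A @\<^sub>c B \<in> carrier_mat m (n + k)"
  using assms by (intro carrier_matI) auto

lemma index_append_cols [simp]:
  assumes "i < dim_row A" and "j < dim_col A + dim_col B"
  shows "(A @\<^sub>c B) $$ (i, j) =
    (if j < dim_col A then A $$ (i, j) else B $$ (i, j - dim_col A))"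
  using assms by (simp add: append_cols_def)

lemma append_zero_cols_zero [simp]: "0\<^sub>m m n @\<^sub>c 0\<^sub>m m k = 0\<^sub>m m (n + k)"
  by (simp add: append_cols_def)

lemma col_append_cols:
  assumes "A \<in> carrier_mat m n" and "B \<in> carrier_mat m k" and "j < n + k"
  shows "col (A @\<^sub>c B) j = (if j < n then col A j else col B (j - n))"
  using assms by (intro eq_vecI) auto

lemma cols_append_cols:
  assumes "A \<in> carrier_mat m n" and "B \<in> carrier_mat m k"
  shows "cols (A @\<^sub>c B) = cols A @ cols B"
  using assms by (intro nth_equalityI) (auto simp: nth_append col_append_cols)

lemma append_cols_eq_iff:
  assumes "A \<in> carrier_mat m n" and "A' \<in> carrier_mat m n"
    and "B \<in> carrier_mat m k" and "B' \<in> carrier_mat m k"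
  shows "A @\<^sub>c B = A' @\<^sub>c B' \<longleftrightarrow> A = A' \<and> B = B'"
proof
  assume "A @\<^sub>c B = A' @\<^sub>c B'"
  then have "cols A @ cols B = cols A' @ cols B'"
    using assms by (simp flip: cols_append_cols)
  then have "cols A = cols A' \<and> cols B = cols B'"
    using assms by (subst (asm) append_eq_append_conv) auto
  then show "A = A' \<and> B = B'"
    using assms by (metis carrier_matD(1) mat_of_cols_cols)
qed simp

lemma mult_append_cols:
  fixes X :: "'a :: semiring_0 mat"
  assumes "X \<in> carrier_mat l m" and "A \<in> carrier_mat m n" and "B \<in> carrier_mat m k"
  shows "X * (A @\<^sub>c B) = (X * A) @\<^sub>c (X * B)"
  using assms by (intro eq_matI) (auto simp: col_append_cols)

lemma hadamard_append_cols:
  assumes "A \<in> carrier_mat m n" and "B \<in> carrier_mat m k"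
    and "A' \<in> carrier_mat m n" and "B' \<in> carrier_mat m k"
  shows "(A @\<^sub>c B) \<circ>\<^sub>H (A' @\<^sub>c B') = (A \<circ>\<^sub>H A') @\<^sub>c (B \<circ>\<^sub>H B')"
  using assms by (intro eq_matI) (auto simp: hadamard_def)

lemma hadamard_carrier [simp, intro]:
  "M \<in> carrier_mat m n \<Longrightarrow> M \<circ>\<^sub>H N \<in> carrier_mat m n"
  by (simp add: hadamard_def)

lemma hadamard_zero_right [simp]:
  fixes M :: "'a :: mult_zero mat"
  assumes "M \<in> carrier_mat m n"
  shows "M \<circ>\<^sub>H 0\<^sub>m m n = 0\<^sub>m m n"
  using assms by (intro eq_matI) (auto simp: hadamard_def)

lemma mult_hadamard_append_cols_eq_zero_iff:
  fixes X :: "'a :: semiring_0 mat"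
  assumes X: "X \<in> carrier_mat m m" and A: "A \<in> carrier_mat m n" and B: "B \<in> carrier_mat m k"
  shows "(X * (A @\<^sub>c B)) \<circ>\<^sub>H (A @\<^sub>c B) = 0\<^sub>m m (n + k) \<longleftrightarrow>
    (X * A) \<circ>\<^sub>H A = 0\<^sub>m m n \<and> (X * B) \<circ>\<^sub>H B = 0\<^sub>m m k"
proof -
  have XA: "X * A \<in> carrier_mat m n" and XB: "X * B \<in> carrier_mat m k"
    using X A B by auto
  have "(X * (A @\<^sub>c B)) \<circ>\<^sub>H (A @\<^sub>c B) = ((X * A) \<circ>\<^sub>H A) @\<^sub>c ((X * B) \<circ>\<^sub>H B)"
    by (simp only: mult_append_cols[OF X A B] hadamard_append_cols[OF XA XB A B])
  then show ?thesis
    using append_cols_eq_iff[OF hadamard_carrier[OF XA] zero_carrier_mat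
        hadamard_carrier[OF XB] zero_carrier_mat]
    by simp
qed

lemma (in vec_space) rank_append_cols:
  assumes A: "A \<in> carrier_mat n a" and B: "B \<in> carrier_mat n b"
    and cols_B: "set (cols B) \<subseteq> span (set (cols A))"
  shows "rank (A @\<^sub>c B) = rank A"
proof -
  have cols_A: "set (cols A) \<subseteq> carrier_vec n"
    using A cols_dim by blast
  have "span (set (cols A) \<union> set (cols B)) = span (set (cols A))"
  proof
    show "span (set (cols A) \<union> set (cols B)) \<subseteq> span (set (cols A))"
      using cols_A cols_B in_own_span[OF cols_A]
      by (intro span_is_subset span_is_submodule) auto
  qed (simp add: span_is_monotone)
  then show ?thesis
    by (simp add: rank_def cols_append_cols[OF A B])
qed

lemma (in vec_space) rank_append_zero_cols:
  assumes "A \<in> carrier_mat n a"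
  shows "rank (A @\<^sub>c 0\<^sub>m n k) = rank A"
proof (rule rank_append_cols[OF assms zero_carrier_mat])
  have "0\<^sub>v n \<in> span (set (cols A))"
    using vectorspace.span_zero[OF vectorspace_axioms] by simp
  then show "set (cols (0\<^sub>m n k)) \<subseteq> span (set (cols A))"
    by (auto simp: cols_def)
qed

theorem proposition3p10:
  fixes A :: "real mat" and m n p :: nat
  assumes "A \<in> carrier_mat m n" and "m \<le> n" and "p > n"
  shows "has_SIPP A \<longleftrightarrow> has_SIPP (A @\<^sub>c 0\<^sub>m m (p - n))"
proof -
  let ?B = "A @\<^sub>c 0\<^sub>m m (p - n)"
  have "vec_space.rank m ?B = vec_space.rank m A"
    by (rule vec_space.rank_append_zero_cols[OF assms(1)])
  moreover have "(X * ?B) \<circ>\<^sub>H ?B = 0\<^sub>m m p \<longleftrightarrow> (X * A) \<circ>\<^sub>H A = 0\<^sub>m m n"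
    if X: "X \<in> carrier_mat m m" for X
    using mult_hadamard_append_cols_eq_zero_iff[OF X assms(1) zero_carrier_mat, of "p - n"]
      X \<open>p > n\<close> by simp
  ultimately show ?thesis
    using assms by (auto simp: has_SIPP_def)
qed

end
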